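(* Let $K$ be a totally real number field with ring of integers $\mathcal O$, and let $\mathcal O^+$ be the set of totally positive elements of $\mathcal O$. For $d\in\mathbb Z^+$ let ${\mathcal O^+}_d$ denote the set of all elements of $\mathcal O^+$ not divisible by $d$ in $\mathcal O$. Then for all $\delta\in\mathcal O^+$ and all $d\in\mathbb Z^+$, $$p(''{\mathcal O^+}_d'',\delta)=p(''\mathcal O^+{}''(\le d-1),\delta).$$
   Context: An element of $\mathcal O$ is totally positive if all its images under the embeddings $K\to\mathbb R$ are positive. A partition of $\delta\in\mathcal O^+$ is a finite sequence $(\lambda_1,\ldots,\lambda_k)$ (with $k$ not fixed) of elements of $\mathcal O^+$, called its parts, with $\lambda_1+\cdots+\lambda_k=\delta$; two partitions are identified if one is a reordering of the other. For $H\subset\mathcal O^+$, $p(''H'',\delta)$ is the number of partitions of $\delta$ all of whose parts lie in $H$, and for an integer $m\ge 0$, $p(''H''(\le m),\delta)$ is the number of partitions of $\delta$ all of whose parts lie in $H$ and in which no part appears more than $m$ times. *)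

theory Defs
  imports
    Complex_Main
    "HOL-Library.Multiset"
    "HOL-Computational_Algebra.Polynomial"
    "Jordan_Normal_Form.Ring_Hom_Matrix"
begin

text \<open>
  A number field is represented by a type \<open>'k\<close> of class \<open>field_char_0\<close> that is
  finite-dimensional as a vector space over its prime field, the rationals.
\<close>

lemma vector_space_of_rat:
  "vector_space (\<lambda>q x. of_rat q * x :: 'k :: field_char_0)"
  by unfold_locales (simp_all add: algebra_simps of_rat_add of_rat_mult)

definition number_field :: "'k :: field_char_0 itself \<Rightarrow> bool" where
  "number_field _ \<longleftrightarrow>
     (\<exists>B :: 'k set. finite B \<and> module.span (\<lambda>(q :: rat) x. of_rat q * x) B = UNIV)"

definition totally_real_number_field :: "'k :: field_char_0 itself \<Rightarrow> bool" where
  "totally_real_number_field K \<longleftrightarrow>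
     number_field K \<and> (\<forall>\<sigma> :: 'k \<Rightarrow> complex. field_hom \<sigma> \<longrightarrow> range \<sigma> \<subseteq> \<real>)"

definition ring_of_integers :: "'k :: field_char_0 set" where
  "ring_of_integers = {x. algebraic_int x}"

definition totally_positive :: "'k :: field_char_0 \<Rightarrow> bool" where
  "totally_positive x \<longleftrightarrow> (\<forall>\<sigma> :: 'k \<Rightarrow> real. field_hom \<sigma> \<longrightarrow> \<sigma> x > 0)"

definition totally_positive_integers :: "'k :: field_char_0 set" where
  "totally_positive_integers = {x \<in> ring_of_integers. totally_positive x}"

text \<open>Divisibility is taken in the ring of integers; \<open>dvd\<close> on \<open>'k\<close> would be divisibility in
  the field.\<close>

definition totally_positive_integers_not_dvd :: "nat \<Rightarrow> 'k :: field_char_0 set" where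
  "totally_positive_integers_not_dvd d =
     {x \<in> totally_positive_integers. \<not> (\<exists>y \<in> ring_of_integers. x = of_nat d * y)}"

text \<open>A finite sequence of parts up to reordering is a multiset.\<close>

definition partitions :: "'k :: field_char_0 \<Rightarrow> 'k multiset set" where
  "partitions \<delta> = {P. set_mset P \<subseteq> totally_positive_integers \<and> \<Sum>\<^sub># P = \<delta>}"

text \<open>For a totally positive integer \<open>\<delta>\<close> of a totally real number field the set of partitions
  of \<open>\<delta>\<close> is finite, so that \<open>card\<close> below does count.\<close>

definition num_partitions :: "'k :: field_char_0 set \<Rightarrow> 'k \<Rightarrow> nat" where
  "num_partitions H \<delta> = card {P \<in> partitions \<delta>. set_mset P \<subseteq> H}"

definition num_partitions_le :: "'k :: field_char_0 set \<Rightarrow> nat \<Rightarrow> 'k \<Rightarrow> nat" where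
  "num_partitions_le H m \<delta> =
     card {P \<in> partitions \<delta>. set_mset P \<subseteq> H \<and> (\<forall>x. count P x \<le> m)}"

end

theory Submission
  imports Defs "Jordan_Normal_Form.Char_Poly"
begin

text \<open>
  The identity generalises Glaisher's theorem on partitions of natural numbers, and so does the
  bijection. Let \<open>d \<ge> 2\<close>. Every \<open>x \<in> O\<^sup>+\<close> is uniquely of the form \<open>d ^ k * y\<close> with \<open>y \<in> O\<^sup>+\<close> not
  divisible by \<open>d\<close>. Replacing every part \<open>d ^ k * y\<close> by \<open>d ^ k\<close> copies of \<open>y\<close> turns a partition of \<open>\<delta>\<close> into one
  whose parts are not divisible by \<open>d\<close>. If no part of the given partition occurs more than \<open>d - 1\<close>
  times, the multiplicities of \<open>y, d * y, d\<^sup>2 * y, \<dots>\<close> are the base \<open>d\<close> digits of the multiplicity of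
  \<open>y\<close> in the new one, and digits determine and are determined by the number. This is
  \<open>glaisher.bij_betw_split_parts\<close>.

  The arithmetic input is that a non-zero algebraic integer is not divisible by all powers of \<open>d\<close>
  (\<open>ex_not_algebraic_int_divide_power\<close>). It follows from two facts: such a number divides a non-zero
  rational integer \<open>m\<close>, and a rational number in \<open>\<int>[y]\<close> for an algebraic integer \<open>y\<close> lies in \<open>\<int>\<close>;
  hence \<open>d ^ k\<close> can divide the number only if it divides \<open>m\<close>.

  The decomposition \<open>d ^ k * y\<close> presupposes \<open>x \<noteq> 0\<close>, that is, \<open>0 \<notin> O\<^sup>+\<close>, which holds as soon as there
  is one embedding into the real numbers. In the remaining case of no such embedding, total
  positivity is vacuous and both sets of partitions are infinite, so that both cardinalities are
  \<open>0\<close> by convention.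
\<close>

section \<open>Algebraic integers and powers of an integer\<close>

text \<open>
  The characteristic polynomial of an integer matrix is monic with integer coefficients, which
  makes this the usual way to certify integrality without exhibiting a polynomial.
\<close>

lemma algebraic_int_if_eigenvalue:
  fixes r :: "'a :: field_char_0"
  assumes A: "A \<in> carrier_mat n n"
    and "eigenvalue (map_mat of_int A) r"
  shows "algebraic_int r"
proof -
  have "poly (map_poly of_int (char_poly A)) r = 0"
    using eigenvalue_root_char_poly[of "map_mat of_int A" n r] assms
    by (simp add: of_int_hom.char_poly_hom[OF A])
  moreover have "lead_coeff (char_poly A) = 1"
    using degree_monic_char_poly[OF A] by simp
  ultimately show ?thesis
    unfolding algebraic_int_altdef_ipoly by blast
qed

text \<open>
  If \<open>y\<close> is a root of a monic polynomial \<open>f\<close> of degree \<open>n\<close>, then \<open>\<int>[y]\<close> is spanned over \<open>\<int>\<close> by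
  \<open>1, y, \<dots>, y ^ (n - 1)\<close>. Multiplication by an element of \<open>\<int>[y]\<close> therefore acts on these powers
  by an integer matrix; the vector of powers is an eigenvector, and that element its eigenvalue.
\<close>

lemma algebraic_int_poly:
  fixes y :: "'a :: field_char_0"
  assumes "algebraic_int y"
  shows "algebraic_int (poly (map_poly of_int h) y)"
proof -
  let ?ev = "\<lambda>p. poly (map_poly of_int p) y"
  obtain f where f: "?ev f = 0" "lead_coeff f = 1"
    using assms unfolding algebraic_int_altdef_ipoly by blast
  define n where "n = degree f"
  have "f \<noteq> 0" using f(2) by auto
  have "n \<noteq> 0"
  proof
    assume "n = 0"
    then have "f = 1" using f(2) by (auto simp: n_def elim!: degree_eq_zeroE)
    then show False using f(1) by simp
  qed
  \<comment> \<open>As \<open>f\<close> is monic, pseudo-division by \<open>f\<close> is an honest division with remainder over \<open>\<int>\<close>.\<close>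
  have "\<exists>s. ?ev s = ?ev g \<and> (s = 0 \<or> degree s < n)" for g
  proof -
    obtain q s where qs: "pseudo_divmod g f = (q, s)" by fastforce
    have "g = f * q + s" "s = 0 \<or> degree s < n"
      using pseudo_divmod[OF \<open>f \<noteq> 0\<close> qs] f(2) by (auto simp: n_def)
    then show ?thesis using f(1)
      by (intro exI[of _ s]) (simp add: hom_distribs)
  qed
  then obtain red where red: "\<And>g. ?ev (red g) = ?ev g" "\<And>g. red g = 0 \<or> degree (red g) < n"
    by metis
  have red_sum: "(\<Sum>j<n. of_int (coeff (red g) j) * y ^ j) = ?ev g" for g
  proof -
    have "\<forall>j\<ge>n. coeff (map_poly of_int (red g) :: 'a poly) j = 0"
      using red(2)[of g] by (auto simp: coeff_map_poly coeff_eq_0)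
    then have "?ev (red g) = (\<Sum>j<n. of_int (coeff (red g) j) * y ^ j)"
      by (auto simp: poly_altdef coeff_map_poly intro!: sum.mono_neutral_cong)
        (metis le_degree not_le_imp_less)+
    then show ?thesis using red(1) by simp
  qed
  define A where "A = Matrix.mat n n (\<lambda>(i, j). coeff (red (monom 1 i * h)) j)"
  define v where "v = Matrix.vec n (\<lambda>i. y ^ i)"
  have A: "A \<in> carrier_mat n n" by (simp add: A_def)
  have "eigenvector (map_mat of_int A) v (?ev h)"
    unfolding eigenvector_def
  proof (intro conjI)
    show "v \<in> carrier_vec (dim_row (map_mat of_int A))" by (simp add: A_def v_def)
    have "v $ 0 \<noteq> 0\<^sub>v n $ 0" using \<open>n \<noteq> 0\<close> by (simp add: v_def)
    then show "v \<noteq> 0\<^sub>v (dim_row (map_mat of_int A))" using A by auto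
    show "map_mat of_int A *\<^sub>v v = ?ev h \<cdot>\<^sub>v v"
    proof (rule eq_vecI)
      fix i assume "i < dim_vec (?ev h \<cdot>\<^sub>v v)"
      then have i: "i < n" by (simp add: v_def)
      then have "(map_mat of_int A *\<^sub>v v) $ i
          = (\<Sum>j<n. of_int (coeff (red (monom 1 i * h)) j) * y ^ j)"
        by (simp add: A_def v_def scalar_prod_def atLeast0LessThan)
      also have "\<dots> = y ^ i * ?ev h"
        by (simp add: red_sum hom_distribs poly_monom)
      finally show "(map_mat of_int A *\<^sub>v v) $ i = (?ev h \<cdot>\<^sub>v v) $ i"
        using i by (simp add: v_def)
    qed (simp add: A_def v_def)
  qed
  then show ?thesis
    using algebraic_int_if_eigenvalue[OF A] unfolding eigenvalue_def by blast
qed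

lemma algebraic_int_of_int_mult:
  fixes y :: "'a :: field_char_0"
  assumes "algebraic_int y"
  shows "algebraic_int (of_int m * y)"
  using algebraic_int_poly[OF assms, of "[:0, m:]"] by (simp add: hom_distribs mult.commute)

text \<open>
  A non-zero algebraic integer \<open>x\<close> divides a non-zero rational integer \<open>m\<close> inside \<open>\<int>[x]\<close>, say
  \<open>m = x * g(x)\<close>: take the lowest non-zero coefficient of an equation for \<open>x\<close>. If \<open>y = x / d ^ k\<close>
  is integral, then so is every element of \<open>\<int>[y]\<close>, in particular
  \<open>y * g(d ^ k * y) = m / d ^ k\<close>; being rational, it lies in \<open>\<int>\<close>. So \<open>d ^ k\<close> divides \<open>m\<close>, which
  bounds \<open>k\<close>.
\<close>

lemma ex_not_algebraic_int_divide_power: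
  fixes x :: "'a :: field_char_0"
  assumes x: "algebraic_int x" "x \<noteq> 0" and d: "d \<ge> 2"
  shows "\<exists>k. \<not> algebraic_int (x / of_nat d ^ k)"
proof (rule ccontr)
  assume "\<not> ?thesis"
  then have div: "algebraic_int (x / of_nat d ^ k)" for k by blast
  let ?ev = "\<lambda>p. poly (map_poly of_int p)"
  obtain g m where gm: "of_int m = x * ?ev g x" "m \<noteq> 0"
  proof -
    obtain f where f: "?ev f x = 0" "f \<noteq> 0"
      using x(1) unfolding algebraic_int_altdef_ipoly by fastforce
    have "\<exists>g m. of_int m = x * ?ev g x \<and> m \<noteq> 0" using f
    proof (induction f)
      case (pCons a p)
      show ?case
      proof (cases "a = 0")
        case True
        \<comment> \<open>Since \<open>x \<noteq> 0\<close>, a vanishing constant coefficient can be divided out of the equation.\<close>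
        then show ?thesis using pCons x(2) by (auto simp: hom_distribs)
      next
        case False
        then show ?thesis using pCons.prems
          by (intro exI[of _ "-p"] exI[of _ a]) (simp add: hom_distribs eq_neg_iff_add_eq_0)
      qed
    qed simp
    then show ?thesis using that by blast
  qed
  have dvd: "int d ^ k dvd m" for k
  proof -
    define y where "y = x / of_nat d ^ k"
    have xy: "x = of_int (int d ^ k) * y" using d by (simp add: y_def)
    define h where "h = [:0, 1:] * pcompose g [:0, int d ^ k:]"
    have "?ev h y = y * ?ev g x"
      by (simp add: h_def hom_distribs poly_pcompose xy mult.commute)
    then have eq: "of_int (int d ^ k) * ?ev h y = of_int m"
      using gm(1) xy by (simp add: mult.assoc)
    then have q: "?ev h y = of_int m / of_int (int d ^ k)"
      using d by (simp add: field_simps)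
    then have "?ev h y \<in> \<rat>" by simp
    then have "?ev h y \<in> \<int>"
      using rational_algebraic_int_is_int algebraic_int_poly[OF div[of k, folded y_def]] by blast
    then obtain c where "?ev h y = of_int c" by (auto elim: Ints_cases)
    with eq have "(of_int (int d ^ k * c) :: 'a) = of_int m" by simp
    then have "int d ^ k * c = m" by (simp only: of_int_eq_iff)
    then show ?thesis by auto
  qed
  then have "int d ^ nat \<bar>m\<bar> \<le> \<bar>m\<bar>"
    using dvd_imp_le_int[OF gm(2) dvd] by simp
  moreover have "nat \<bar>m\<bar> < d ^ nat \<bar>m\<bar>" using d by (simp add: less_exp power_gt_expt)
  ultimately show False by (simp add: nat_less_iff)
qed


section \<open>Glaisher's bijection\<close>

lemma base_expansion_unique:
  fixes a b :: "nat \<Rightarrow> nat"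
  assumes "\<And>k. a k < d" "\<And>k. b k < d"
    and "(\<Sum>k<N. a k * d ^ k) = (\<Sum>k<N. b k * d ^ k)" and "k < N"
  shows "a k = b k"
  using assms
proof (induction N arbitrary: a b k)
  case (Suc N)
  have shift: "(\<Sum>k<Suc N. c k * d ^ k) = c 0 + d * (\<Sum>k<N. c (Suc k) * d ^ k)" for c :: "nat \<Rightarrow> nat"
    by (simp only: sum.lessThan_Suc_shift) (simp add: sum_distrib_left mult_ac)
  have eq: "a 0 + d * (\<Sum>k<N. a (Suc k) * d ^ k) = b 0 + d * (\<Sum>k<N. b (Suc k) * d ^ k)"
    using Suc.prems(3) unfolding shift .
  from arg_cong[OF eq, of "\<lambda>n. n mod d"] have "a 0 = b 0"
    using Suc.prems(1,2) by simp
  moreover have "d \<noteq> 0" using Suc.prems(1)[of 0] by auto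
  ultimately have "(\<Sum>k<N. a (Suc k) * d ^ k) = (\<Sum>k<N. b (Suc k) * d ^ k)"
    using eq by simp
  then have "a (Suc j) = b (Suc j)" if "j < N" for j
    by (intro Suc.IH[of "\<lambda>k. a (Suc k)" "\<lambda>k. b (Suc k)"] Suc.prems(1,2) that)
  then show ?case
    using \<open>a 0 = b 0\<close> Suc.prems(4) by (cases k) simp_all
qed simp

text \<open>
  Glaisher's argument uses only that every element of \<open>H\<close> is, in exactly one way, a power of \<open>d\<close>
  times an element of \<open>T\<close>. The elements of \<open>T\<close> are then the elements of \<open>H\<close> that are not \<open>d\<close> times
  an element of \<open>H\<close>.
\<close>

locale glaisher =
  fixes d :: nat and T H :: "'a :: comm_semiring_1 set"
  assumes d_ge_2: "d \<ge> 2"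
    and bij: "bij_betw (\<lambda>(k, y). of_nat d ^ k * y) (UNIV \<times> T) H"
begin

definition level :: "'a \<Rightarrow> nat" where
  "level x = fst (inv_into (UNIV \<times> T) (\<lambda>(k, y). of_nat d ^ k * y) x)"

definition core :: "'a \<Rightarrow> 'a" where
  "core x = snd (inv_into (UNIV \<times> T) (\<lambda>(k, y). of_nat d ^ k * y) x)"

lemma level_power_mult: "y \<in> T \<Longrightarrow> level (of_nat d ^ k * y) = k"
  and core_power_mult: "y \<in> T \<Longrightarrow> core (of_nat d ^ k * y) = y"
  using bij_betw_inv_into_left[OF bij, of "(k, y)"] by (simp_all add: level_def core_def)

lemma
  assumes "x \<in> H"
  shows core_in: "core x \<in> T" and power_level_core: "of_nat d ^ level x * core x = x"
proof -
  show "core x \<in> T"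
    using bij_betwE[OF bij_betw_inv_into[OF bij]] assms unfolding core_def by fastforce
  show "of_nat d ^ level x * core x = x"
    using bij_betw_inv_into_right[OF bij assms] by (simp add: level_def core_def case_prod_unfold)
qed

lemma power_mult_in: "y \<in> T \<Longrightarrow> of_nat d ^ k * y \<in> H"
  using bij_betwE[OF bij] by force

lemma T_subset: "T \<subseteq> H"
  using power_mult_in[of _ 0] by auto

text \<open>
  One direction of Glaisher's bijection: a part \<open>d ^ k * y\<close> with \<open>y \<in> T\<close> is cut into \<open>d ^ k\<close> parts \<open>y\<close>,
  which leaves the sum unchanged.
\<close>

definition split_parts :: "'a multiset \<Rightarrow> 'a multiset" where
  "split_parts Q = (\<Sum>x\<in>#Q. replicate_mset (d ^ level x) (core x))"

lemma split_parts_simps [simp]: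
  "split_parts {#} = {#}"
  "split_parts (add_mset x Q) = replicate_mset (d ^ level x) (core x) + split_parts Q"
  "split_parts (Q + R) = split_parts Q + split_parts R"
  by (simp_all add: split_parts_def)

lemma set_split_parts: "set_mset Q \<subseteq> H \<Longrightarrow> set_mset (split_parts Q) \<subseteq> T"
  by (auto simp: split_parts_def core_in subset_iff split: if_splits)

lemma sum_split_parts: "set_mset Q \<subseteq> H \<Longrightarrow> \<Sum>\<^sub># (split_parts Q) = \<Sum>\<^sub># Q"
  by (induction Q) (simp_all add: sum_mset_replicate_mset power_level_core)

lemma split_parts_eq_self: "set_mset P \<subseteq> T \<Longrightarrow> split_parts P = P"
proof (induction P)
  case (add y P)
  then show ?case
    using level_power_mult[of y 0] core_power_mult[of y 0] by simp
qed simp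

text \<open>
  Where no part occurs \<open>d\<close> times, the multiplicities of \<open>y, d * y, d\<^sup>2 * y, \<dots>\<close> in \<open>Q\<close> are by this
  formula the base \<open>d\<close> digits of the multiplicity of \<open>y\<close> after splitting.
\<close>

lemma count_split_parts:
  assumes "set_mset Q \<subseteq> H" "y \<in> T" "\<And>x. x \<in># Q \<Longrightarrow> level x < N"
  shows "count (split_parts Q) y = (\<Sum>k<N. count Q (of_nat d ^ k * y) * d ^ k)"
  using assms
proof (induction Q)
  case (add x Q)
  have x: "x \<in> H" "level x < N" using add.prems by auto
  have single: "of_nat d ^ k * y = x \<longleftrightarrow> k = level x \<and> core x = y" for k
    using power_level_core[OF x(1)] level_power_mult[OF add.prems(2), of k]
      core_power_mult[OF add.prems(2), of k] by metis
  have "(\<Sum>k<N. count (add_mset x Q) (of_nat d ^ k * y) * d ^ k)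
      = (\<Sum>k<N. (if of_nat d ^ k * y = x then d ^ k else 0)
          + count Q (of_nat d ^ k * y) * d ^ k)"
    by (intro sum.cong) auto
  also have "\<dots> = (\<Sum>k<N. if of_nat d ^ k * y = x then d ^ k else 0) + count (split_parts Q) y"
    using add by (simp add: sum.distrib)
  also have "(\<Sum>k<N. if of_nat d ^ k * y = x then d ^ k else 0)
      = (\<Sum>k<N. if k = level x then if core x = y then d ^ k else 0 else 0)"
    unfolding single by (intro sum.cong) auto
  also have "\<dots> = (if core x = y then d ^ level x else 0)"
    using x(2) by simp
  finally show ?case by simp
qed simp

lemma inj_on_split_parts:
  "inj_on split_parts {Q. set_mset Q \<subseteq> H \<and> (\<forall>x. count Q x < d)}"
proof (rule inj_onI, clarsimp)
  fix Q R
  assume Q: "set_mset Q \<subseteq> H" "\<forall>x. count Q x < d"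
    and R: "set_mset R \<subseteq> H" "\<forall>x. count R x < d" and eq: "split_parts Q = split_parts R"
  define N where "N = Suc (Max (level ` set_mset (Q + R)))"
  have N: "level x < N" if "x \<in># Q + R" for x
    using that unfolding N_def by (intro le_imp_less_Suc Max_ge) auto
  have "count Q x = count R x" for x
  proof (cases "x \<in># Q + R")
    case True
    then have x: "x \<in> H" using Q(1) R(1) by auto
    have "count Q (of_nat d ^ level x * core x) = count R (of_nat d ^ level x * core x)"
      using base_expansion_unique[of "\<lambda>k. count Q (of_nat d ^ k * core x)" d
          "\<lambda>k. count R (of_nat d ^ k * core x)" N "level x"]
        count_split_parts[OF Q(1) core_in[OF x], of N] count_split_parts[OF R(1) core_in[OF x], of N]
        eq Q(2) R(2) N True
      by simp
    then show ?thesis using power_level_core[OF x] by simp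
  qed (simp add: not_in_iff)
  then show "Q = R" by (simp add: multiset_eq_iff)
qed

text \<open>
  Replacing \<open>d\<close> copies of a part \<open>x\<close> by the single part \<open>d * x\<close> changes neither the sum nor the
  result of splitting, and shortens the partition because \<open>d \<ge> 2\<close>. Hence repeating it comes to an
  end, at a partition in which no part occurs \<open>d\<close> times.
\<close>

lemma ex_reduced_split_parts_eq:
  "set_mset Q \<subseteq> H \<Longrightarrow> \<exists>R. set_mset R \<subseteq> H \<and> (\<forall>x. count R x < d) \<and> split_parts R = split_parts Q"
proof (induction "size Q" arbitrary: Q rule: less_induct)
  case less
  show ?case
  proof (cases "\<forall>x. count Q x < d")
    case False
    then obtain x where "d \<le> count Q x" by (auto simp: not_less)
    then have sub: "replicate_mset d x \<subseteq># Q" by (simp add: count_le_replicate_mset_subset_eq)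
    then obtain S where S: "Q = replicate_mset d x + S" by (auto simp: mset_subset_eq_exists_conv)
    have x: "x \<in> H" using S less.prems d_ge_2 by auto
    define z where "z = of_nat d * x"
    have z_eq: "z = of_nat d ^ Suc (level x) * core x"
      using power_level_core[OF x] by (simp add: z_def mult.assoc)
    then have z: "z \<in> H" "level z = Suc (level x)" "core z = core x"
      using core_in[OF x] by (simp_all only: power_mult_in level_power_mult core_power_mult)
    have rep: "split_parts (replicate_mset m x) = replicate_mset (m * d ^ level x) (core x)" for m
      by (induction m) (simp_all add: multiset_eq_iff)
    have "split_parts (add_mset z S) = split_parts Q"
      by (simp add: S rep z)
    moreover have "size (add_mset z S) < size Q" using d_ge_2 by (simp add: S)
    moreover have "set_mset (add_mset z S) \<subseteq> H" using z(1) less.prems S by auto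
    ultimately show ?thesis using less.hyps by metis
  qed (use less.prems in blast)
qed

text \<open>
  Injectivity is the uniqueness of base \<open>d\<close> expansions. For surjectivity, a partition into parts
  from \<open>T\<close> is its own splitting, and merging equal parts turns it into a preimage.
\<close>

theorem bij_betw_split_parts:
  "bij_betw split_parts {Q. set_mset Q \<subseteq> H \<and> (\<forall>x. count Q x < d) \<and> \<Sum>\<^sub># Q = s}
     {P. set_mset P \<subseteq> T \<and> \<Sum>\<^sub># P = s}"
  unfolding bij_betw_def
proof (intro conjI equalityI subsetI)
  show "inj_on split_parts {Q. set_mset Q \<subseteq> H \<and> (\<forall>x. count Q x < d) \<and> \<Sum>\<^sub># Q = s}"
    by (rule inj_on_subset[OF inj_on_split_parts]) auto
next
  fix P assume P: "P \<in> {P. set_mset P \<subseteq> T \<and> \<Sum>\<^sub># P = s}"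
  then obtain R where R: "set_mset R \<subseteq> H" "\<forall>x. count R x < d" "split_parts R = split_parts P"
    using ex_reduced_split_parts_eq[of P] T_subset by auto
  then have "P = split_parts R" "\<Sum>\<^sub># R = s" using P split_parts_eq_self[of P] sum_split_parts[of R] by auto
  then show "P \<in> split_parts ` {Q. set_mset Q \<subseteq> H \<and> (\<forall>x. count Q x < d) \<and> \<Sum>\<^sub># Q = s}"
    using R by blast
qed (use set_split_parts sum_split_parts in auto)

end


section \<open>Divisibility of totally positive integers\<close>

lemma totally_positive_of_nat_mult_iff:
  fixes x :: "'k :: field_char_0"
  assumes "n > 0"
  shows "totally_positive (of_nat n * x) \<longleftrightarrow> totally_positive x"
proof -
  have "0 < \<sigma> (of_nat n * x) \<longleftrightarrow> 0 < \<sigma> x" if "field_hom \<sigma>" for \<sigma> :: "'k \<Rightarrow> real"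
  proof -
    interpret field_hom \<sigma> by fact
    show ?thesis using assms by (simp add: hom_mult hom_of_nat zero_less_mult_iff)
  qed
  then show ?thesis by (auto simp: totally_positive_def)
qed

lemma of_nat_mult_in_totally_positive_integers:
  "n > 0 \<Longrightarrow> x \<in> totally_positive_integers \<Longrightarrow> of_nat n * x \<in> totally_positive_integers"
  using algebraic_int_of_int_mult[of x "int n"]
  by (simp add: totally_positive_integers_def ring_of_integers_def totally_positive_of_nat_mult_iff)

lemma totally_positive_integers_not_dvd_subset:
  "totally_positive_integers_not_dvd d \<subseteq> totally_positive_integers"
  by (auto simp: totally_positive_integers_not_dvd_def)

text \<open>
  Divide \<open>x\<close> by \<open>d\<close> as long as the quotient is integral. The process stops by
  \<open>ex_not_algebraic_int_divide_power\<close>, and total positivity is not affected by it.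
\<close>

lemma ex_power_mult_not_dvd:
  fixes x :: "'k :: field_char_0"
  assumes x: "x \<in> totally_positive_integers" "x \<noteq> 0" and d: "d \<ge> 2"
  shows "\<exists>k. \<exists>y \<in> totally_positive_integers_not_dvd d. x = of_nat d ^ k * y"
proof -
  let ?P = "\<lambda>k. \<not> algebraic_int (x / of_nat d ^ k)"
  have int: "algebraic_int x"
    using x(1) by (simp add: totally_positive_integers_def ring_of_integers_def)
  define j where "j = (LEAST k. ?P k)"
  have j: "?P j"
    unfolding j_def using ex_not_algebraic_int_divide_power[OF int x(2) d] by (rule LeastI_ex)
  then have "j \<noteq> 0" using int by (cases j) auto
  then obtain k where k: "j = Suc k" using not0_implies_Suc by blast
  define y where "y = x / of_nat d ^ k"
  have xy: "x = of_nat (d ^ k) * y" using d by (simp add: y_def)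
  have "algebraic_int y" using not_less_Least[of k ?P] k by (simp add: y_def j_def)
  moreover have "totally_positive y"
    using x(1) d totally_positive_of_nat_mult_iff[of "d ^ k" y]
    by (simp add: xy totally_positive_integers_def)
  moreover have False if "y = of_nat d * z" "algebraic_int z" for z
  proof -
    have "z = x / of_nat d ^ j" using that(1) d by (simp add: xy k)
    then show False using j that(2) by simp
  qed
  ultimately have "y \<in> totally_positive_integers_not_dvd d"
    by (auto simp: totally_positive_integers_not_dvd_def totally_positive_integers_def
        ring_of_integers_def)
  then show ?thesis using xy by (metis of_nat_power)
qed

lemma power_mult_not_dvd_le:
  fixes x y :: "'k :: field_char_0"
  assumes d: "d > 0" and x: "x \<in> totally_positive_integers_not_dvd d"
    and y: "y \<in> totally_positive_integers"
    and eq: "of_nat d ^ k * x = of_nat d ^ l * y"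
  shows "l \<le> k"
proof (rule ccontr)
  assume "\<not> l \<le> k"
  define i where "i = l - Suc k"
  have "l = k + Suc i" using \<open>\<not> l \<le> k\<close> by (simp add: i_def)
  then have "x = of_nat d * (of_nat (d ^ i) * y)" using eq d by (simp add: power_add mult_ac)
  moreover have "of_nat (d ^ i) * y \<in> totally_positive_integers"
    using of_nat_mult_in_totally_positive_integers[OF _ y, of "d ^ i"] d by simp
  ultimately show False
    using x by (auto simp: totally_positive_integers_not_dvd_def totally_positive_integers_def)
qed

lemma bij_betw_power_mult_not_dvd:
  assumes "0 \<notin> (totally_positive_integers :: 'k :: field_char_0 set)" and d: "d \<ge> 2"
  shows "bij_betw (\<lambda>(k, y). of_nat d ^ k * y) (UNIV \<times> totally_positive_integers_not_dvd d)
    (totally_positive_integers :: 'k set)"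
  unfolding bij_betw_def
proof
  show "inj_on (\<lambda>(k, y). of_nat d ^ k * y)
      (UNIV \<times> (totally_positive_integers_not_dvd d :: 'k set))"
  proof (rule inj_onI, clarify)
    fix k l and x y :: 'k
    assume *: "x \<in> totally_positive_integers_not_dvd d" "y \<in> totally_positive_integers_not_dvd d"
      and eq: "of_nat d ^ k * x = of_nat d ^ l * y"
    have "k = l"
      using power_mult_not_dvd_le[OF _ *(1) _ eq] power_mult_not_dvd_le[OF _ *(2) _ eq[symmetric]]
        * d totally_positive_integers_not_dvd_subset[of d]
      by (intro antisym) auto
    then show "k = l \<and> x = y" using eq d by simp
  qed
  show "(\<lambda>(k, y). of_nat d ^ k * y) ` (UNIV \<times> totally_positive_integers_not_dvd d)
      = (totally_positive_integers :: 'k set)" (is "?A = ?B")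
  proof
    show "?A \<subseteq> ?B"
      using of_nat_mult_in_totally_positive_integers[of "d ^ k" for k]
        totally_positive_integers_not_dvd_subset[of d] d by auto
    show "?B \<subseteq> ?A"
    proof
      fix x :: 'k assume x: "x \<in> totally_positive_integers"
      then have "x \<noteq> 0" using assms(1) by auto
      from ex_power_mult_not_dvd[OF x this d] show "x \<in> ?A" by force
    qed
  qed
qed


section \<open>Partitions in the absence of real embeddings\<close>

text \<open>
  An embedding maps \<open>0\<close> to \<open>0\<close>, so \<open>0\<close> is totally positive only if there is no real embedding, and
  then the positivity condition is vacuous.
\<close>

lemma totally_positive_integers_eq_if_zero:
  assumes "(0 :: 'k :: field_char_0) \<in> totally_positive_integers"
  shows "(totally_positive_integers :: 'k set) = ring_of_integers"
proof -
  have "\<not> field_hom \<sigma>" for \<sigma> :: "'k \<Rightarrow> real"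
  proof
    assume hom: "field_hom \<sigma>"
    then interpret field_hom \<sigma> .
    show False using assms hom
      by (auto simp: totally_positive_integers_def totally_positive_def)
  qed
  then show ?thesis by (auto simp: totally_positive_integers_def totally_positive_def)
qed

text \<open>
  Once \<open>1\<close> and \<open>-1\<close> are admissible parts, any number of pairs \<open>1 + (-1)\<close> can be added to a
  partition. A partition to start from is \<open>x = y + \<dots> + y\<close> with \<open>d ^ k\<close> summands, where
  \<open>x = d ^ k * y\<close>.
\<close>

lemma infinite_partitions_not_dvd:
  fixes x :: "'k :: field_char_0"
  assumes zero: "(0 :: 'k) \<in> totally_positive_integers"
    and x: "x \<in> totally_positive_integers" and d: "d \<ge> 2"
  shows "infinite {P. set_mset P \<subseteq> totally_positive_integers_not_dvd d \<and> \<Sum>\<^sub># P = x}"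
    (is "infinite ?S")
proof -
  note int = totally_positive_integers_eq_if_zero[OF zero] ring_of_integers_def
  have unit: "u \<in> totally_positive_integers_not_dvd d" if u: "u = 1 \<or> u = (-1 :: 'k)" for u
  proof -
    have False if eq: "u = of_nat d * y" and alg: "algebraic_int y" for y
    proof -
      have "y = u / of_nat d" using eq d by simp
      then have "y \<in> \<rat>" using u by auto
      then obtain c where "y = of_int c"
        using rational_algebraic_int_is_int[OF alg] by (blast elim: Ints_cases)
      then have "(of_int (int d * c) :: 'k) = of_int 1 \<or> (of_int (int d * c) :: 'k) = of_int (-1)"
        using eq u by simp
      then have "int d * c = 1 \<or> int d * c = -1" by (simp only: of_int_eq_iff)
      then have "int d dvd 1" by (metis dvd_minus_iff dvd_triv_left)
      then show False using d by simp
    qed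
    then show ?thesis using u
      by (auto simp: totally_positive_integers_not_dvd_def int)
  qed
  obtain B where B: "B \<in> ?S"
  proof (cases "x = 0")
    case True
    then show ?thesis by (intro that[of "{#}"]) simp
  next
    case False
    from ex_power_mult_not_dvd[OF x this d] obtain k y
      where "y \<in> totally_positive_integers_not_dvd d" "x = of_nat d ^ k * y" by blast
    then show ?thesis
      by (intro that[of "replicate_mset (d ^ k) y"])
        (auto simp: sum_mset_replicate_mset split: if_splits)
  qed
  define P where "P n = replicate_mset n 1 + replicate_mset n (-1) + B" for n
  have "P n \<in> ?S" for n
    using B unit by (auto simp: P_def sum_mset_replicate_mset split: if_splits)
  moreover have "inj P"
    by (rule inj_on_inverseI[of _ "\<lambda>R. (size R - size B) div 2"]) (simp add: P_def)
  ultimately show ?thesis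
    using infinite_super[of "range P" ?S] finite_imageD[of P UNIV] by auto
qed

text \<open>
  The partitions \<open>x + n + (-n)\<close> with \<open>n \<noteq> 0\<close> and \<open>n \<noteq> x, -x\<close> have three distinct parts each.
\<close>

lemma infinite_partitions_count_less:
  fixes x :: "'k :: field_char_0"
  assumes zero: "(0 :: 'k) \<in> totally_positive_integers"
    and x: "x \<in> totally_positive_integers" and d: "d \<ge> 2"
  shows "infinite {P. set_mset P \<subseteq> totally_positive_integers \<and> (\<forall>y. count P y < d) \<and> \<Sum>\<^sub># P = x}"
    (is "infinite ?S")
proof -
  define P where "P n = {#x, of_nat n, - of_nat n#}" for n
  define N where "N = {n. n \<noteq> 0 \<and> of_nat n \<noteq> x \<and> - of_nat n \<noteq> x}"
  have "inj_on P N"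
  proof (rule inj_onI)
    fix m n assume "P m = P n"
    then have "{#of_nat m, - of_nat m#} = {#of_nat n, - of_nat n :: 'k#}"
      by (simp add: P_def)
    then have "(of_nat m :: 'k) = of_nat n \<or> (of_nat m :: 'k) = - of_nat n"
      by (auto simp: add_eq_conv_ex)
    then show "m = n"
    proof
      assume "(of_nat m :: 'k) = - of_nat n"
      then have "(of_nat (m + n) :: 'k) = 0" by simp
      then show ?thesis by (simp only: of_nat_eq_0_iff)
    qed simp
  qed
  moreover have "infinite N"
  proof -
    have "finite {n. (of_nat n :: 'k) = c}" for c
      using finite_vimageI[of "{c}" "of_nat :: nat \<Rightarrow> 'k"] by (simp add: inj_of_nat vimage_def)
    from this[of x] this[of "-x"] have "finite {n. n = 0 \<or> of_nat n = x \<or> of_nat n = -x}"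
      by (simp add: Collect_disj_eq)
    moreover have "N = - {n. n = 0 \<or> of_nat n = x \<or> of_nat n = -x}"
      by (auto simp: N_def minus_equation_iff)
    ultimately show ?thesis by (simp add: finite_compl)
  qed
  moreover have "P ` N \<subseteq> ?S"
  proof (rule image_subsetI)
    fix n assume n: "n \<in> N"
    have "(of_nat n :: 'k) \<noteq> - of_nat n"
    proof
      assume "(of_nat n :: 'k) = - of_nat n"
      then have "(of_nat (n + n) :: 'k) = 0" by (simp add: eq_neg_iff_add_eq_0)
      then show False using n by (simp only: of_nat_eq_0_iff) (simp add: N_def)
    qed
    then have le_1: "count (P n) y \<le> 1" for y using n by (auto simp: P_def N_def)
    have "count (P n) y < d" for y using le_1[of y] d by simp
    moreover have "set_mset (P n) \<subseteq> totally_positive_integers"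
      using x by (auto simp: P_def totally_positive_integers_eq_if_zero[OF zero] ring_of_integers_def)
    ultimately show "P n \<in> ?S" by (simp add: P_def)
  qed
  ultimately show ?thesis
    using finite_imageD[of P N] infinite_super[of "P ` N" ?S] by blast
qed


section \<open>Partitions of totally positive integers\<close>

theorem corollary4p2:
  fixes \<delta> :: "'k :: field_char_0" and d :: nat
  assumes "totally_real_number_field TYPE('k)"
    and "\<delta> \<in> totally_positive_integers"
    and "d > 0"
  shows "num_partitions (totally_positive_integers_not_dvd d) \<delta> =
         num_partitions_le totally_positive_integers (d - 1) \<delta>"
proof -
  let ?T = "totally_positive_integers_not_dvd d :: 'k set"
  let ?H = "totally_positive_integers :: 'k set"
  let ?L = "{P. set_mset P \<subseteq> ?T \<and> \<Sum>\<^sub># P = \<delta>}"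
  let ?R = "{Q. set_mset Q \<subseteq> ?H \<and> (\<forall>x. count Q x < d) \<and> \<Sum>\<^sub># Q = \<delta>}"
  have "num_partitions ?T \<delta> = card ?L"
    using totally_positive_integers_not_dvd_subset[of d]
    unfolding num_partitions_def partitions_def by (intro arg_cong[of _ _ card]) auto
  moreover have "num_partitions_le ?H (d - 1) \<delta> = card ?R"
  proof -
    have "n \<le> d - 1 \<longleftrightarrow> n < d" for n using \<open>d > 0\<close> by auto
    then show ?thesis
      unfolding num_partitions_le_def partitions_def by (intro arg_cong[of _ _ card]) auto
  qed
  moreover have "card ?L = card ?R"
  proof (cases "d = 1")
    case True
    \<comment> \<open>Everything is divisible by \<open>1\<close>, so that on both sides only the empty partition qualifies.\<close>
    have "?T = {}"
      using True by (auto simp: totally_positive_integers_not_dvd_def totally_positive_integers_def)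
    then have "set_mset P \<subseteq> ?T \<longleftrightarrow> P = {#}" for P by auto
    moreover have "(\<forall>x. count Q x < d) \<longleftrightarrow> Q = {#}" for Q :: "'k multiset"
      using True by (auto simp: multiset_eq_iff)
    ultimately show ?thesis by (intro arg_cong[of _ _ card]) auto
  next
    case False
    then have d: "d \<ge> 2" using \<open>d > 0\<close> by simp
    show ?thesis
    proof (cases "0 \<in> ?H")
      case True
      \<comment> \<open>The cardinality of an infinite set is \<open>0\<close>, so both sides are \<open>0\<close>.\<close>
      then show ?thesis
        using infinite_partitions_not_dvd[OF _ assms(2) d]
          infinite_partitions_count_less[OF _ assms(2) d] by simp
    next
      case False
      then interpret glaisher d ?T ?H
        by unfold_locales (use d bij_betw_power_mult_not_dvd in auto)
      show ?thesis using bij_betw_same_card[OF bij_betw_split_parts] by simp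
    qed
  qed
  ultimately show ?thesis by simp
qed

end
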